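(* For $a>0$ let $R$ be a rectangle of side lengths $2$ and $2a$. Using the uniform distribution, choose two points $p_1,p_2\in R$ independently. Let $p(a)$ denote the probability that the orthogonal projection of the center of $R$ onto the line containing $[p_1,p_2]$ is contained in the segment $[p_1,p_2]$. Then $p(a)$ is a quasiconcave function of $a\in(0,\infty)$, which is maximal if, and only if, $a=1$.
   Context: A function on an interval is called quasiconcave here if it has one single (local) maximum and no (local) minima. *)

theory Defs
  imports "HOL-Probability.Probability"
begin

text \<open>Closed (solid) rectangle in the plane, in arbitrary position, with given center and
  given lengths of its two pairs of sides.\<close>

definition is_rectangle :: "real^2 \<Rightarrow> real \<Rightarrow> real \<Rightarrow> (real^2) set \<Rightarrow> bool" where
  "is_rectangle c w h R \<longleftrightarrow>
     (\<exists>u v. norm u = 1 \<and> norm v = 1 \<and> orthogonal u v \<and>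
        R = {c + s *\<^sub>R u + t *\<^sub>R v | s t. \<bar>s\<bar> \<le> w / 2 \<and> \<bar>t\<bar> \<le> h / 2})"

text \<open>Only meaningful if \<open>A\<close> is a nonempty affine subspace (closed, as always in finite
  dimension).\<close>

definition orth_proj :: "'a::euclidean_space set \<Rightarrow> 'a \<Rightarrow> 'a" where
  "orth_proj A x = (THE q. q \<in> A \<and> (\<forall>y\<in>A. orthogonal (x - q) (y - q)))"

text \<open>For \<open>p1 = p2\<close> the affine hull degenerates to a point; this has probability zero.\<close>

definition proj_prob :: "(real^2) set \<Rightarrow> real^2 \<Rightarrow> real" where
  "proj_prob R c =
     measure (uniform_measure lborel R \<Otimes>\<^sub>M uniform_measure lborel R)
       {(p1, p2). orth_proj (affine hull {p1, p2}) c \<in> closed_segment p1 p2}"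

definition local_max_on :: "real set \<Rightarrow> (real \<Rightarrow> real) \<Rightarrow> real \<Rightarrow> bool" where
  "local_max_on I f x \<longleftrightarrow> x \<in> I \<and> (\<forall>\<^sub>F y in at x within I. f y \<le> f x)"

definition local_min_on :: "real set \<Rightarrow> (real \<Rightarrow> real) \<Rightarrow> real \<Rightarrow> bool" where
  "local_min_on I f x \<longleftrightarrow> x \<in> I \<and> (\<forall>\<^sub>F y in at x within I. f x \<le> f y)"

text \<open>This is not the usual notion of quasiconcavity (convex superlevel sets). Local extrema
  are meant in the non-strict sense, so plateaus are excluded.\<close>

definition quasiconcave_on :: "real set \<Rightarrow> (real \<Rightarrow> real) \<Rightarrow> bool" where
  "quasiconcave_on I f \<longleftrightarrow>
     is_interval I \<and> (\<exists>!x. local_max_on I f x) \<and> (\<nexists>x. local_min_on I f x)"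

end

theory Submission
  imports Defs
begin

text \<open>Put the center of the rectangle at the origin. The foot of the perpendicular from the center to the
  line through \<open>p1\<close> and \<open>p2\<close> misses the segment exactly if \<open>p1 \<bullet> (p2 - p1) > 0\<close> or
  \<open>p2 \<bullet> (p1 - p2) > 0\<close>. These two events exclude each other, because the two inner products add up
  to \<open>-(norm (p1 - p2))\<^sup>2\<close>, and they are equally likely by symmetry. In coordinates along the sides,
  scaled to the square \<open>[-1, 1]\<^sup>2\<close>, the first event reads \<open>X + a\<^sup>2 * Y > 0\<close>, where \<open>X = x * (y - x)\<close>
  and \<open>Y = s * (t - s)\<close> for independent uniform \<open>x, y, s, t\<close> in \<open>[-1, 1]\<close>. Hence
  \<open>p(a) = 1 - 2 * q(a\<^sup>2)\<close> with \<open>q(l) = P(X + l * Y > 0)\<close>, and the two side directions enter only through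
  two independent copies of one and the same real random variable, the excess.

  Exchanging \<open>X\<close> and \<open>Y\<close> gives \<open>q(1 / l) = q(l)\<close>. It remains to see that \<open>q\<close> is strictly
  increasing on \<open>[1, \<infinity>)\<close>. Let \<open>\<alpha>(u)\<close> and \<open>\<beta>(w)\<close> be the densities of the excess at the positive
  value \<open>u\<close> and at the negative value \<open>-w\<close>. When \<open>l\<close> grows to \<open>l'\<close>, the event \<open>X + l * Y > 0\<close> gains the pairs
  \<open>(X, Y) = (-w, v)\<close> and loses the pairs \<open>(X, Y) = (w, -v)\<close> with \<open>l * v < w < l' * v\<close>, up to null sets,
  so that \<open>q(l') - q(l)\<close> is the integral of \<open>\<alpha>(v) * \<beta>(w) - \<alpha>(w) * \<beta>(v)\<close> over the wedge
  \<open>l * v < w < l' * v\<close> of the quadrant \<open>v, w > 0\<close>.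
  For \<open>l \<ge> 1\<close> only \<open>v < w\<close> occurs, and the integrand is nonnegative there as soon as the ratio
  \<open>\<alpha> / \<beta>\<close> decreases. Both densities are explicit logarithms (\<open>excess_law_eq_density\<close>), and the
  monotonicity of their ratio (\<open>density_ratio_decreasing\<close>) is elementary calculus.\<close>

section \<open>Feet of perpendiculars on segments\<close>

text \<open>The foot of the perpendicular is \<open>p1 + t *\<^sub>R (p2 - p1)\<close> with \<open>t\<close> determined by orthogonality;
  the two inner products are \<open>t\<close> and \<open>1 - t\<close> times the squared distance of the points. For \<open>p1 = p2\<close>
  both sides hold, so the equivalence has no exceptional pairs.\<close>
lemma orth_proj_in_closed_segment_iff:
  fixes c p1 p2 :: "'a::euclidean_space"
  shows "orth_proj (affine hull {p1, p2}) c \<in> closed_segment p1 p2 \<longleftrightarrow>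
    0 \<le> (p1 - c) \<bullet> (p1 - p2) \<and> 0 \<le> (p2 - c) \<bullet> (p2 - p1)"
proof (cases "p1 = p2")
  case True
  then show ?thesis by (auto simp: orth_proj_def orthogonal_def)
next
  case False
  define d where "d = p2 - p1"
  define t where "t = ((c - p1) \<bullet> d) / (d \<bullet> d)"
  have d: "d \<noteq> 0" "0 < d \<bullet> d" using False by (auto simp: d_def)
  have td: "t * (d \<bullet> d) = (c - p1) \<bullet> d" using d by (simp add: t_def)
  have hull: "affine hull {p1, p2} = range (\<lambda>k. p1 + k *\<^sub>R d)"
    unfolding affine_hull_2_alt d_def by auto
  have "orth_proj (affine hull {p1, p2}) c = p1 + t *\<^sub>R d"
    unfolding orth_proj_def hull
  proof (rule the_equality)
    have "orthogonal (c - (p1 + t *\<^sub>R d)) ((p1 + k *\<^sub>R d) - (p1 + t *\<^sub>R d))" for k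
    proof -
      have "(c - (p1 + t *\<^sub>R d)) \<bullet> d = 0"
        using td by (simp add: algebra_simps inner_simps)
      moreover have "(p1 + k *\<^sub>R d) - (p1 + t *\<^sub>R d) = (k - t) *\<^sub>R d"
        by (simp add: algebra_simps)
      ultimately show ?thesis by (simp add: orthogonal_def)
    qed
    then show "p1 + t *\<^sub>R d \<in> range (\<lambda>k. p1 + k *\<^sub>R d) \<and>
      (\<forall>y\<in>range (\<lambda>k. p1 + k *\<^sub>R d). orthogonal (c - (p1 + t *\<^sub>R d)) (y - (p1 + t *\<^sub>R d)))"
      by auto
  next
    fix q assume q: "q \<in> range (\<lambda>k. p1 + k *\<^sub>R d) \<and>
      (\<forall>y\<in>range (\<lambda>k. p1 + k *\<^sub>R d). orthogonal (c - q) (y - q))"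
    then obtain k where k: "q = p1 + k *\<^sub>R d" by auto
    have "orthogonal (c - q) ((p1 + (k + 1) *\<^sub>R d) - q)" using q by blast
    then have "(c - q) \<bullet> d = 0" by (simp add: k orthogonal_def algebra_simps)
    then have "(c - p1) \<bullet> d = k * (d \<bullet> d)" by (simp add: k inner_simps algebra_simps)
    then show "q = p1 + t *\<^sub>R d" using d by (simp add: t_def k)
  qed
  moreover have "p1 + t *\<^sub>R d \<in> closed_segment p1 p2 \<longleftrightarrow> 0 \<le> t \<and> t \<le> 1"
  proof -
    have "p1 + t *\<^sub>R d \<in> closed_segment p1 p2 \<longleftrightarrow>
        (\<exists>k. 0 \<le> k \<and> k \<le> 1 \<and> p1 + t *\<^sub>R d = p1 + k *\<^sub>R d)"
      unfolding in_segment d_def by (simp add: algebra_simps)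
    then show ?thesis using d by auto
  qed
  moreover have "(p1 - c) \<bullet> (p1 - p2) = t * (d \<bullet> d)" "(p2 - c) \<bullet> (p2 - p1) = (1 - t) * (d \<bullet> d)"
    using td by (simp_all add: d_def inner_simps algebra_simps inner_commute)
  moreover have "0 \<le> k * (d \<bullet> d) \<longleftrightarrow> 0 \<le> k" for k
    using mult_le_cancel_right_pos[OF d(2), of 0 k] by simp
  ultimately show ?thesis by simp
qed

section \<open>The uniform distribution on a rectangle in coordinates\<close>

lemma vector_2_eq_axis: "(vector [s, t] :: real^2) = s *\<^sub>R axis 1 1 + t *\<^sub>R axis 2 1"
  by (simp add: vec_eq_iff forall_2 axis_def)

text \<open>Passing from \<open>real \<times> real\<close> to \<open>real^2\<close> with its standard axes preserves boxes; an orthonormal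
  frame differs from the standard axes by an orthogonal transformation.\<close>
lemma lborel_distr_orthonormal:
  fixes u v :: "real^2"
  assumes "norm u = 1" "norm v = 1" "orthogonal u v"
  shows "distr (lborel \<Otimes>\<^sub>M lborel) borel (\<lambda>(s, t). s *\<^sub>R u + t *\<^sub>R v) = lborel"
proof -
  have uv: "u \<bullet> u = 1" "v \<bullet> v = 1" "u \<bullet> v = 0" "v \<bullet> u = 0"
    using assms by (simp_all add: norm_eq_1 orthogonal_def inner_commute)
  have vec[measurable]: "(\<lambda>(s, t). vector [s, t] :: real^2) \<in> lborel \<Otimes>\<^sub>M lborel \<rightarrow>\<^sub>M borel"
    by (simp add: lborel_prod, intro borel_measurable_continuous_onI)
       (auto simp: case_prod_unfold vector_2_eq_axis intro!: continuous_intros)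
  have axes: "distr (lborel \<Otimes>\<^sub>M lborel) borel (\<lambda>(s, t). vector [s, t] :: real^2) = lborel"
  proof (rule lborel_eqI[symmetric])
    fix l u :: "real^2" assume lu: "\<And>b. b \<in> Basis \<Longrightarrow> l \<bullet> b \<le> u \<bullet> b"
    have le: "l $ i \<le> u $ i" for i
      using lu[of "axis i 1"] by (simp add: inner_axis axis_in_Basis_iff)
    have pre: "(\<lambda>(s, t). vector [s, t] :: real^2) -` box l u = {l $ 1<..<u $ 1} \<times> {l $ 2<..<u $ 2}"
      by (auto simp: mem_box_cart forall_2)
    have "(\<Prod>b\<in>Basis. (u - l) \<bullet> b) = (u $ 1 - l $ 1) * (u $ 2 - l $ 2)"
      by (simp add: Basis_vec_def UNIV_2 axis_eq_axis inner_axis)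
    then show "emeasure (distr (lborel \<Otimes>\<^sub>M lborel) borel (\<lambda>(s, t). vector [s, t])) (box l u) =
        ennreal (\<Prod>b\<in>Basis. (u - l) \<bullet> b)"
      using le by (simp add: emeasure_distr pre space_pair_measure lborel.emeasure_pair_measure_Times ennreal_mult)
  qed simp
  define T where "T = (\<lambda>x::real^2. x $ 1 *\<^sub>R u + x $ 2 *\<^sub>R v)"
  have lin: "linear T" by (auto simp: T_def linear_iff algebra_simps)
  have orth: "orthogonal_transformation T"
    unfolding orthogonal_transformation
  proof (intro conjI allI lin)
    fix x show "norm (T x) = norm x"
      by (simp add: norm_eq_sqrt_inner T_def inner_simps uv inner_vec_def[of x] sum_2)
  qed
  have T[measurable]: "T \<in> borel \<rightarrow>\<^sub>M borel" unfolding T_def by measurable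
  have "distr lborel borel T = lborel"
  proof (rule lborel_eqI[symmetric])
    fix l u :: "real^2" assume lu: "\<And>b. b \<in> Basis \<Longrightarrow> l \<bullet> b \<le> u \<bullet> b"
    have im: "T -` box l u = inv T ` box l u"
      using orthogonal_transformation_bij[OF orth] by (simp add: bij_vimage_eq_inv_image)
    have o: "orthogonal_transformation (inv T)" by (rule orthogonal_transformation_inv[OF orth])
    have "emeasure (distr lborel borel T) (box l u) = emeasure lborel (T -` box l u)"
      by (simp add: emeasure_distr)
    also have "\<dots> = emeasure lebesgue (inv T ` box l u)"
      using measurable_sets[OF T, of "box l u"] by (simp add: im)
    also have "\<dots> = ennreal (measure lebesgue (inv T ` box l u))"
      by (rule emeasure_eq_measure2[OF measurable_orthogonal_image[OF o lmeasurable_box]])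
    also have "\<dots> = ennreal (measure lebesgue (box l u))"
      using measure_orthogonal_image[OF o, of "box l u"] by simp
    also have "\<dots> = (\<Prod>b\<in>Basis. (u - l) \<bullet> b)"
      using lu by (simp add: measure_lborel_box_eq)
    finally show "emeasure (distr lborel borel T) (box l u) = (\<Prod>b\<in>Basis. (u - l) \<bullet> b)" .
  qed simp
  moreover have "(\<lambda>(s, t). s *\<^sub>R u + t *\<^sub>R v) = T \<circ> (\<lambda>(s, t). vector [s, t])"
    by (auto simp: T_def)
  ultimately show ?thesis
    using axes distr_distr[OF _ vec, of T borel] T by simp
qed

lemma emeasure_lborel_rectangle_coordinates:
  fixes u v c :: "real^2"
  assumes uv: "norm u = 1" "norm v = 1" "orthogonal u v" and "0 < a"
    and [measurable]: "A \<in> sets borel"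
  defines "\<phi> \<equiv> \<lambda>z. c + fst z *\<^sub>R u + (a * snd z) *\<^sub>R v"
  shows "emeasure lborel A = ennreal a * emeasure (lborel \<Otimes>\<^sub>M lborel) (\<phi> -` A)"
proof -
  have [measurable]: "(\<lambda>(s, t). s *\<^sub>R u + t *\<^sub>R v) \<in> lborel \<Otimes>\<^sub>M lborel \<rightarrow>\<^sub>M borel"
    unfolding case_prod_unfold by measurable
  have \<phi>[measurable]: "\<phi> \<in> lborel \<Otimes>\<^sub>M lborel \<rightarrow>\<^sub>M borel"
    unfolding \<phi>_def by measurable
  have "emeasure lborel A = (\<integral>\<^sup>+x. indicator A x \<partial>distr lborel borel ((+) c))"
    by (simp add: lborel_distr_plus)
  also have "\<dots> = (\<integral>\<^sup>+x. indicator A (c + x) \<partial>distr (lborel \<Otimes>\<^sub>M lborel) borel (\<lambda>(s, t). s *\<^sub>R u + t *\<^sub>R v))"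
    by (subst nn_integral_distr) (simp_all add: lborel_distr_orthonormal[OF uv])
  also have "\<dots> = (\<integral>\<^sup>+z. indicator A (c + (fst z *\<^sub>R u + snd z *\<^sub>R v)) \<partial>(lborel \<Otimes>\<^sub>M lborel))"
    by (subst nn_integral_distr) (auto simp: case_prod_unfold)
  also have "\<dots> = (\<integral>\<^sup>+s. (\<integral>\<^sup>+t. indicator A (c + (s *\<^sub>R u + t *\<^sub>R v)) \<partial>lborel) \<partial>lborel)"
    by (subst lborel.nn_integral_fst[symmetric]) auto
  also have "\<dots> = (\<integral>\<^sup>+s. ennreal a * (\<integral>\<^sup>+t. indicator A (\<phi> (s, t)) \<partial>lborel) \<partial>lborel)"
    using \<open>0 < a\<close>
    by (intro nn_integral_cong, subst nn_integral_real_affine[where c=a and t=0])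
       (auto simp: \<phi>_def add.assoc)
  also have "\<dots> = ennreal a * (\<integral>\<^sup>+z. indicator A (\<phi> z) \<partial>(lborel \<Otimes>\<^sub>M lborel))"
    by (subst nn_integral_cmult, measurable) (subst lborel.nn_integral_fst, auto)
  also have "(\<integral>\<^sup>+z. indicator A (\<phi> z) \<partial>(lborel \<Otimes>\<^sub>M lborel)) = (\<integral>\<^sup>+z. indicator (\<phi> -` A) z \<partial>(lborel \<Otimes>\<^sub>M lborel))"
    by (simp add: indicator_vimage comp_def)
  also have "\<dots> = emeasure (lborel \<Otimes>\<^sub>M lborel) (\<phi> -` A)"
    using measurable_sets[OF \<phi>, of A] by (simp add: space_pair_measure)
  finally show ?thesis .
qed

definition unif :: "real measure" where
  "unif = uniform_measure lborel {-1..1}"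

lemma sets_unif[simp, measurable_cong]: "sets unif = sets borel"
  by (simp add: unif_def)

lemma space_unif[simp]: "space unif = UNIV"
  by (simp add: unif_def)

interpretation unif: prob_space unif
  unfolding unif_def by (rule prob_space_uniform_measure) auto

interpretation unif_pair: pair_prob_space unif unif ..

lemma nn_integral_unif:
  assumes [measurable]: "f \<in> borel_measurable borel"
  shows "(\<integral>\<^sup>+x. f x \<partial>unif) = (\<integral>\<^sup>+x. f x * indicator {-1..1} x / 2 \<partial>lborel)"
  unfolding unif_def by (subst nn_integral_uniform_measure) (auto simp: nn_integral_divide)

lemma nn_integral_unif_pair:
  assumes [measurable]: "f \<in> borel_measurable (borel \<Otimes>\<^sub>M borel)"
  shows "(\<integral>\<^sup>+z. f z \<partial>(unif \<Otimes>\<^sub>M unif)) =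
    (\<integral>\<^sup>+x. (\<integral>\<^sup>+y. f (x, y) * indicator {-1..1} x * indicator {-1..1} y / 4 \<partial>lborel) \<partial>lborel)"
proof -
  have "(\<integral>\<^sup>+z. f z \<partial>(unif \<Otimes>\<^sub>M unif)) = (\<integral>\<^sup>+x. (\<integral>\<^sup>+y. f (x, y) \<partial>unif) \<partial>unif)"
    by (subst unif.nn_integral_fst) auto
  also have "\<dots> = (\<integral>\<^sup>+x. (\<integral>\<^sup>+y. f (x, y) * indicator {-1..1} y / 2 \<partial>lborel) * indicator {-1..1} x / 2 \<partial>lborel)"
    by (simp add: nn_integral_unif)
  also have "\<dots> = (\<integral>\<^sup>+x. (\<integral>\<^sup>+y. f (x, y) * indicator {-1..1} x * indicator {-1..1} y / 4 \<partial>lborel) \<partial>lborel)"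
  proof (rule nn_integral_cong)
    fix x
    have "inverse (2::ennreal) = ennreal (1/2)" "inverse (4::ennreal) = ennreal (1/4)"
      using inverse_ennreal[of 2] inverse_ennreal[of 4] by simp_all
    then have "inverse (2::ennreal) * inverse 2 = inverse 4"
      using ennreal_mult[of "1/2" "1/2"] by (simp only:) simp
    then have four: "t / 2 / 2 = t / 4" for t :: ennreal
      by (simp only: divide_ennreal_def mult.assoc)
    show "(\<integral>\<^sup>+y. f (x, y) * indicator {-1..1} y / 2 \<partial>lborel) * indicator {-1..1} x / 2 =
      (\<integral>\<^sup>+y. f (x, y) * indicator {-1..1} x * indicator {-1..1} y / 4 \<partial>lborel)"
      by (simp add: nn_integral_divide four split: split_indicator)
  qed
  finally show ?thesis .
qed

lemma unif_pair_eq_uniform_square: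
  "unif \<Otimes>\<^sub>M unif = uniform_measure (lborel \<Otimes>\<^sub>M lborel) ({-1..1} \<times> {-1..1})"
proof (rule measure_eqI)
  show "sets (unif \<Otimes>\<^sub>M unif) = sets (uniform_measure (lborel \<Otimes>\<^sub>M lborel) ({-1..1} \<times> {-1..1}))"
    by (simp cong: sets_pair_measure_cong)
  fix A assume A0: "A \<in> sets (unif \<Otimes>\<^sub>M unif)"
  then have A[measurable]: "A \<in> sets (borel \<Otimes>\<^sub>M borel)" by (simp cong: sets_pair_measure_cong)
  let ?S = "{-1..1} \<times> {-1..1} :: (real \<times> real) set"
  have S[measurable]: "?S \<in> sets (borel \<Otimes>\<^sub>M borel)" by measurable
  have "emeasure (lborel \<Otimes>\<^sub>M lborel) ?S = 4"
    by (simp add: lborel.emeasure_pair_measure_Times)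
  then have "emeasure (uniform_measure (lborel \<Otimes>\<^sub>M lborel) ?S) A
      = emeasure (lborel \<Otimes>\<^sub>M lborel) (?S \<inter> A) / 4"
    using A S by (subst emeasure_uniform_measure) (auto cong: sets_pair_measure_cong)
  also have "\<dots> = (\<integral>\<^sup>+z. indicator (?S \<inter> A) z \<partial>(lborel \<Otimes>\<^sub>M lborel)) / 4"
    using A S by (subst nn_integral_indicator) (auto cong: sets_pair_measure_cong)
  also have "\<dots> = (\<integral>\<^sup>+x. (\<integral>\<^sup>+y. indicator (?S \<inter> A) (x, y) \<partial>lborel) / 4 \<partial>lborel)"
    by (subst lborel.nn_integral_fst[symmetric], measurable) (subst nn_integral_divide, measurable)
  also have "\<dots> = (\<integral>\<^sup>+x. (\<integral>\<^sup>+y. indicator A (x, y) * indicator {-1..1} x * indicator {-1..1} y / 4 \<partial>lborel) \<partial>lborel)"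
    by (subst nn_integral_divide[symmetric]) (auto intro!: nn_integral_cong split: split_indicator)
  also have "\<dots> = (\<integral>\<^sup>+z. indicator A z \<partial>(unif \<Otimes>\<^sub>M unif))"
    by (rule nn_integral_unif_pair[symmetric]) measurable
  also have "\<dots> = emeasure (unif \<Otimes>\<^sub>M unif) A"
    using A0 by simp
  finally show "emeasure (unif \<Otimes>\<^sub>M unif) A = emeasure (uniform_measure (lborel \<Otimes>\<^sub>M lborel) ?S) A" ..
qed

text \<open>The coordinates are scaled to the fixed square \<open>[-1, 1]\<^sup>2\<close>, so that the shape of the rectangle
  survives only in the coordinate map.\<close>
lemma uniform_measure_rectangle:
  fixes u v c :: "real^2"
  assumes uv: "norm u = 1" "norm v = 1" "orthogonal u v" and a: "0 < a"
  defines "\<phi> \<equiv> \<lambda>z. c + fst z *\<^sub>R u + (a * snd z) *\<^sub>R v"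
  shows "uniform_measure lborel {c + s *\<^sub>R u + t *\<^sub>R v | s t. \<bar>s\<bar> \<le> 1 \<and> \<bar>t\<bar> \<le> a}
    = distr (unif \<Otimes>\<^sub>M unif) borel \<phi>" (is "uniform_measure lborel ?R = _")
proof (rule measure_eqI)
  show "sets (uniform_measure lborel ?R) = sets (distr (unif \<Otimes>\<^sub>M unif) borel \<phi>)" by simp
  fix A assume "A \<in> sets (uniform_measure lborel ?R)"
  then have A: "A \<in> sets borel" by simp
  let ?S = "{-1..1} \<times> {-1..1} :: (real \<times> real) set"
  let ?L = "lborel \<Otimes>\<^sub>M lborel :: (real \<times> real) measure"
  have uv': "u \<bullet> u = 1" "v \<bullet> v = 1" "u \<bullet> v = 0" "v \<bullet> u = 0"
    using uv by (simp_all add: norm_eq_1 orthogonal_def inner_commute)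
  have R: "?R = \<phi> ` ?S"
  proof (intro equalityI subsetI)
    fix x assume "x \<in> ?R"
    then obtain s t where "x = c + s *\<^sub>R u + t *\<^sub>R v" "\<bar>s\<bar> \<le> 1" "\<bar>t\<bar> \<le> a" by auto
    then show "x \<in> \<phi> ` ?S"
      using a by (intro image_eqI[of _ _ "(s, t / a)"]) (auto simp: \<phi>_def abs_le_iff field_simps)
  next
    fix x assume "x \<in> \<phi> ` ?S"
    then obtain s t where "x = c + s *\<^sub>R u + (a * t) *\<^sub>R v" "\<bar>s\<bar> \<le> 1" "\<bar>t\<bar> \<le> 1"
      by (auto simp: \<phi>_def abs_le_iff)
    then show "x \<in> ?R"
      using a by (intro CollectI exI[of _ s] exI[of _ "a * t"]) (auto simp: abs_mult mult_left_le)
  qed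
  have cont: "continuous_on UNIV \<phi>" unfolding \<phi>_def by (intro continuous_intros)
  have \<phi>[measurable]: "\<phi> \<in> ?L \<rightarrow>\<^sub>M borel" "\<phi> \<in> unif \<Otimes>\<^sub>M unif \<rightarrow>\<^sub>M borel"
    unfolding \<phi>_def by measurable
  have "inj \<phi>"
  proof (rule injI)
    fix z w assume eq: "\<phi> z = \<phi> w"
    have "(\<phi> z - c) \<bullet> u = fst z" "(\<phi> z - c) \<bullet> v = a * snd z" for z
      by (simp_all add: \<phi>_def inner_simps uv')
    from this[of z] this[of w] have "fst z = fst w" "snd z = snd w" using a by (auto simp: eq)
    then show "z = w" by (simp add: prod_eq_iff)
  qed
  then have pre: "\<phi> -` ?R = ?S" unfolding R by (rule inj_vimage_image_eq)
  have "compact ?R" unfolding R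
    by (intro compact_continuous_image continuous_on_subset[OF cont] compact_Times) auto
  then have Rm: "?R \<in> sets borel" by (intro borel_closed compact_imp_closed)
  have "emeasure (uniform_measure lborel ?R) A = emeasure lborel (?R \<inter> A) / emeasure lborel ?R"
    using A Rm by simp
  also have "\<dots> = (ennreal a * emeasure ?L (?S \<inter> \<phi> -` A)) / (ennreal a * emeasure ?L ?S)"
    using emeasure_lborel_rectangle_coordinates[OF uv a Rm, of c]
      emeasure_lborel_rectangle_coordinates[OF uv a, of "?R \<inter> A" c] A Rm pre
    by (simp add: \<phi>_def[symmetric] del: vimage_Collect_eq)
  also have "\<dots> = emeasure ?L (?S \<inter> \<phi> -` A) / emeasure ?L ?S"
    using a by (subst (1 2) mult.commute, intro divide_mult_eq) auto
  also have "\<dots> = emeasure (unif \<Otimes>\<^sub>M unif) (\<phi> -` A)"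
    using measurable_sets[OF \<phi>(1) A]
    by (simp add: unif_pair_eq_uniform_square space_pair_measure)
  also have "\<dots> = emeasure (distr (unif \<Otimes>\<^sub>M unif) borel \<phi>) A"
    using A by (simp add: emeasure_distr space_pair_measure)
  finally show "emeasure (uniform_measure lborel ?R) A = emeasure (distr (unif \<Otimes>\<^sub>M unif) borel \<phi>) A" .
qed

section \<open>The density of the excess\<close>

definition excess_law :: "real measure" where
  "excess_law = distr (unif \<Otimes>\<^sub>M unif) borel (\<lambda>(x, y). x * (y - x))"

lemma sets_excess_law [simp, measurable_cong]: "sets excess_law = sets borel"
  by (simp add: excess_law_def)

lemma space_excess_law [simp]: "space excess_law = UNIV"
  by (simp add: excess_law_def)

interpretation excess: prob_space excess_law
  unfolding excess_law_def by (rule unif_pair.prob_space_distr) measurable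

interpretation excess_pair: pair_prob_space excess_law excess_law ..

text \<open>The densities of \<open>x * (y - x)\<close>, for independent uniform \<open>x, y\<close> in \<open>[-1, 1]\<close>, at the value \<open>u > 0\<close> and at
  the value \<open>-w < 0\<close>. They are half the logarithm of the quotient of the endpoints of the interval
  in which \<open>\<bar>x\<bar>\<close> must lie for the value to be possible: the roots of \<open>x\<^sup>2 - x + u\<close> in the first case,
  the positive root of \<open>x\<^sup>2 + x - w\<close> and \<open>1\<close> in the second.\<close>
definition pos_density :: "real \<Rightarrow> real" where
  "pos_density u = (if 0 < u \<and> u < 1/4 then ln ((1 + sqrt (1 - 4 * u)) / (1 - sqrt (1 - 4 * u))) / 2 else 0)"

definition neg_density :: "real \<Rightarrow> real" where
  "neg_density w = (if 0 < w \<and> w < 2 then ln (2 / (sqrt (1 + 4 * w) - 1)) / 2 else 0)"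

lemma pos_density_pos: "0 < u \<Longrightarrow> u < 1/4 \<Longrightarrow> 0 < pos_density u"
proof -
  assume u: "0 < u" "u < 1/4"
  have "0 < sqrt (1 - 4 * u)" "sqrt (1 - 4 * u) < 1" using u by auto
  then have "1 < (1 + sqrt (1 - 4 * u)) / (1 - sqrt (1 - 4 * u))" by (simp add: less_divide_eq)
  then show ?thesis using u ln_gt_zero[OF \<open>1 < _\<close>] by (simp add: pos_density_def)
qed

lemma neg_density_pos: "0 < w \<Longrightarrow> w < 2 \<Longrightarrow> 0 < neg_density w"
proof -
  assume w: "0 < w" "w < 2"
  have "sqrt (1 + 4 * w) < sqrt 9" using w by (intro real_sqrt_less_mono) auto
  then have "1 < sqrt (1 + 4 * w)" "sqrt (1 + 4 * w) < 3" using w by (auto simp: real_sqrt_less_iff)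
  then show ?thesis using w by (simp add: neg_density_def)
qed

lemma pos_density_nonneg: "0 \<le> pos_density u"
  using pos_density_pos[of u] by (cases "0 < u \<and> u < 1/4") (auto simp: pos_density_def)

lemma neg_density_nonneg: "0 \<le> neg_density u"
  using neg_density_pos[of u] by (cases "0 < u \<and> u < 2") (auto simp: neg_density_def)

definition excess_density :: "real \<Rightarrow> real" where
  "excess_density u = pos_density u + neg_density (- u)"

lemma excess_density_pos: "0 < u \<Longrightarrow> excess_density u = pos_density u"
  by (simp add: excess_density_def neg_density_def)

lemma excess_density_neg: "0 < u \<Longrightarrow> excess_density (- u) = neg_density u"
  by (simp add: excess_density_def pos_density_def)

lemma borel_measurable_densities [measurable]:
  "pos_density \<in> borel_measurable borel" "neg_density \<in> borel_measurable borel"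
  "excess_density \<in> borel_measurable borel"
  unfolding pos_density_def[abs_def] neg_density_def[abs_def] excess_density_def[abs_def] by measurable

lemma nn_integral_inverse_abs_annulus:
  fixes lo hi :: real
  assumes "0 < lo" "lo \<le> hi"
  shows "(\<integral>\<^sup>+x. ennreal (1 / (4 * \<bar>x\<bar>)) * (if lo \<le> \<bar>x\<bar> \<and> \<bar>x\<bar> \<le> hi then 1 else 0) \<partial>lborel) =
    ennreal (ln (hi / lo) / 2)"
proof -
  have half: "(\<integral>\<^sup>+x. ennreal (1 / (4 * \<bar>x\<bar>)) * indicator {lo..hi} x \<partial>lborel) = ennreal (ln hi / 4 - ln lo / 4)"
    by (rule nn_integral_FTC_Icc)
       (use assms in \<open>auto intro!: derivative_eq_intros\<close>)
  have mirror: "(\<integral>\<^sup>+x. ennreal (1 / (4 * \<bar>x\<bar>)) * indicator {-hi..-lo} x \<partial>lborel) =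
      (\<integral>\<^sup>+x. ennreal (1 / (4 * \<bar>x\<bar>)) * indicator {lo..hi} x \<partial>lborel)"
    by (subst nn_integral_real_affine[where c="-1" and t=0]) (auto intro!: nn_integral_cong split: split_indicator)
  have "(\<integral>\<^sup>+x. ennreal (1 / (4 * \<bar>x\<bar>)) * (if lo \<le> \<bar>x\<bar> \<and> \<bar>x\<bar> \<le> hi then 1 else 0) \<partial>lborel) =
      (\<integral>\<^sup>+x. ennreal (1 / (4 * \<bar>x\<bar>)) * indicator {lo..hi} x
         + ennreal (1 / (4 * \<bar>x\<bar>)) * indicator {-hi..-lo} x \<partial>lborel)"
    using assms by (intro nn_integral_cong) (auto split: split_indicator)
  also have "\<dots> = ennreal (ln hi / 4 - ln lo / 4) + ennreal (ln hi / 4 - ln lo / 4)"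
    by (subst nn_integral_add) (auto simp: half mirror)
  also have "\<dots> = ennreal (ln (hi / lo) / 2)"
    using assms by (simp add: ennreal_plus[symmetric] ln_div del: ennreal_plus) 
  finally show ?thesis .
qed

text \<open>For fixed \<open>x\<close> the excess is uniformly distributed with density \<open>1 / (2 * \<bar>x\<bar>)\<close> on the values \<open>u\<close> for which
  \<open>y = x + u / x\<close> lies in \<open>[-1, 1]\<close>; averaging over \<open>x\<close> gives the density at \<open>u\<close>. The condition
  on \<open>x\<close> is \<open>\<bar>x\<^sup>2 + u\<bar> \<le> \<bar>x\<bar> \<le> 1\<close>, which describes an interval for \<open>\<bar>x\<bar>\<close>. The excluded
  values of \<open>u\<close> are the ends of the range of the excess and the singularity of its density.\<close>
lemma nn_integral_excess_kernel:
  fixes u :: real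
  assumes "u \<noteq> 0" "u \<noteq> 1/4" "u \<noteq> -2"
  shows "(\<integral>\<^sup>+x. ennreal (1 / (4 * \<bar>x\<bar>)) * (indicator {-1..1} x * indicator {-1..1} (x + u / x)) \<partial>lborel) =
    ennreal (excess_density u)"
proof -
  \<comment> \<open>The condition on \<open>x\<close> depends on \<open>y = \<bar>x\<bar>\<close> only.\<close>
  define S where "S y \<longleftrightarrow> y \<le> 1 \<and> \<bar>y\<^sup>2 + u\<bar> \<le> y" for y :: real
  have S: "indicator {-1..1} x * indicator {-1..1} (x + u / x) = (if S \<bar>x\<bar> then 1 else 0 :: ennreal)"
    if "x \<noteq> 0" for x
  proof -
    have "x + u / x = (x\<^sup>2 + u) / x" using that by (simp add: field_simps power2_eq_square)
    then have "\<bar>x + u / x\<bar> \<le> 1 \<longleftrightarrow> \<bar>x\<^sup>2 + u\<bar> \<le> \<bar>x\<bar>" using that by (simp add: divide_le_eq)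
    then show ?thesis by (auto simp: S_def abs_le_iff split: split_indicator)
  qed
  have "(\<integral>\<^sup>+x. ennreal (1 / (4 * \<bar>x\<bar>)) * (indicator {-1..1} x * indicator {-1..1} (x + u / x)) \<partial>lborel)
      = (\<integral>\<^sup>+x. ennreal (1 / (4 * \<bar>x\<bar>)) * (if S \<bar>x\<bar> then 1 else 0) \<partial>lborel)"
  proof (rule nn_integral_cong)
    fix x
    show "ennreal (1 / (4 * \<bar>x\<bar>)) * (indicator {-1..1} x * indicator {-1..1} (x + u / x)) =
        ennreal (1 / (4 * \<bar>x\<bar>)) * (if S \<bar>x\<bar> then 1 else 0)"
      using S[of x] by (cases "x = 0") simp_all
  qed
  also have "\<dots> = ennreal (excess_density u)"
  proof -
    consider "0 < u" "u < 1/4" | "1/4 < u" | "-2 < u" "u < 0" | "u < -2" using assms by linarith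
    then show ?thesis
    proof cases
      case 1
      define r where "r = sqrt (1 - 4 * u)"
      have r: "0 < r" "r < 1" "u = (1 - r\<^sup>2) / 4" using 1 by (auto simp: r_def)
      have "S y \<longleftrightarrow> (1 - r) / 2 \<le> y \<and> y \<le> (1 + r) / 2" if "0 \<le> y" for y
      proof -
        have "S y \<longleftrightarrow> y \<le> 1 \<and> y\<^sup>2 + u - y \<le> 0" using that 1 by (auto simp: S_def)
        also have "y\<^sup>2 + u - y = (y - (1 - r) / 2) * (y - (1 + r) / 2)"
          unfolding r(3) by (simp add: power2_eq_square field_simps)
        also have "y \<le> 1 \<and> \<dots> \<le> 0 \<longleftrightarrow> (1 - r) / 2 \<le> y \<and> y \<le> (1 + r) / 2"
          using r(1,2) by (auto simp: mult_le_0_iff)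
        finally show ?thesis .
      qed
      then have "(\<integral>\<^sup>+x. ennreal (1 / (4 * \<bar>x\<bar>)) * (if S \<bar>x\<bar> then 1 else 0) \<partial>lborel)
          = ennreal (ln (((1 + r) / 2) / ((1 - r) / 2)) / 2)"
        using nn_integral_inverse_abs_annulus[of "(1 - r) / 2" "(1 + r) / 2"] r by simp
      moreover have "(p / 2) / (q / 2) = p / q" for p q :: real by simp
      moreover have "ln ((1 + r) / (1 - r)) / 2 = excess_density u"
        using 1 by (simp add: excess_density_def pos_density_def neg_density_def r_def)
      ultimately show ?thesis by (simp only:)
    next
      case 2
      have "\<not> S y" for y
      proof -
        have "0 \<le> (y - 1/2)\<^sup>2" by simp
        then have "y - 1/4 \<le> y\<^sup>2" by (simp add: power2_eq_square algebra_simps)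
        then show ?thesis using 2 by (auto simp: S_def)
      qed
      then show ?thesis using 2 by (simp add: excess_density_def pos_density_def neg_density_def)
    next
      case 3
      define r where "r = sqrt (1 - 4 * u)"
      have r2: "r\<^sup>2 = 1 - 4 * u" using 3 by (simp add: r_def)
      have "1 < r" using 3 by (simp add: r_def)
      moreover have "r < 3" using r2 3 power_mono[of 3 r 2] by (cases "r < 3") auto
      ultimately have r: "1 < r" "r < 3" "u = (1 - r\<^sup>2) / 4" using r2 by auto
      have "S y \<longleftrightarrow> (r - 1) / 2 \<le> y \<and> y \<le> 1" if "0 \<le> y" for y
      proof -
        have "y\<^sup>2 \<le> y" if "y \<le> 1" using that \<open>0 \<le> y\<close> by (simp add: power2_eq_square mult_left_le)
        then have "S y \<longleftrightarrow> y \<le> 1 \<and> 0 \<le> y\<^sup>2 + u + y" using 3 by (auto simp: S_def)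
        also have "y\<^sup>2 + u + y = (y - (r - 1) / 2) * (y + (r + 1) / 2)"
          unfolding r(3) by (simp add: power2_eq_square field_simps)
        also have "0 \<le> \<dots> \<longleftrightarrow> (r - 1) / 2 \<le> y"
        proof -
          have "0 < y + (r + 1) / 2" using r(1) that by (intro add_nonneg_pos) auto
          from mult_le_cancel_right_pos[OF this, of 0] show ?thesis by simp
        qed
        finally show ?thesis by blast
      qed
      then have "(\<integral>\<^sup>+x. ennreal (1 / (4 * \<bar>x\<bar>)) * (if S \<bar>x\<bar> then 1 else 0) \<partial>lborel)
          = ennreal (ln (1 / ((r - 1) / 2)) / 2)"
        using nn_integral_inverse_abs_annulus[of "(r - 1) / 2" 1] r by simp
      moreover have "1 / ((r - 1) / 2) = 2 / (r - 1)" by simp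
      moreover have "ln (2 / (r - 1)) / 2 = excess_density u"
        using 3 by (simp add: excess_density_def pos_density_def neg_density_def r_def)
      ultimately show ?thesis by (simp only:)
    next
      case 4
      have "\<not> S y" if "0 \<le> y" for y
      proof
        assume "S y"
        then have "y \<le> 1" "- y \<le> y\<^sup>2 + u" by (auto simp: S_def)
        moreover have "y\<^sup>2 \<le> 1" using \<open>y \<le> 1\<close> that by (simp add: power_le_one)
        ultimately show False using 4 by simp
      qed
      then show ?thesis using 4 by (simp add: excess_density_def pos_density_def neg_density_def)
    qed
  qed
  finally show ?thesis .
qed

text \<open>Substitute \<open>u = x * (y - x)\<close> for \<open>y\<close> in the inner integral and exchange the order of integration.\<close>
lemma excess_law_eq_density: "excess_law = density lborel excess_density"
proof (rule measure_eqI)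
  show "sets excess_law = sets (density lborel (\<lambda>x. ennreal (excess_density x)))"
    by (simp add: excess_law_def)
  fix A assume A0: "A \<in> sets excess_law"
  then have A[measurable]: "A \<in> sets borel" by (simp add: excess_law_def)
  let ?k = "\<lambda>x u::real. ennreal (1 / (4 * \<bar>x\<bar>)) * (indicator {-1..1} x * indicator {-1..1} (x + u / x))"
  have k[measurable]: "case_prod ?k \<in> borel_measurable (borel \<Otimes>\<^sub>M borel)"
    unfolding case_prod_unfold by measurable
  have "emeasure excess_law A = (\<integral>\<^sup>+z. indicator A z \<partial>excess_law)"
    by (rule nn_integral_indicator[symmetric, OF A0])
  also have "\<dots> = (\<integral>\<^sup>+z. indicator A (fst z * (snd z - fst z)) \<partial>(unif \<Otimes>\<^sub>M unif))"
    unfolding excess_law_def case_prod_unfold by (subst nn_integral_distr) auto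
  also have "\<dots> = (\<integral>\<^sup>+x. (\<integral>\<^sup>+y. indicator A (x * (y - x)) * indicator {-1..1} x * indicator {-1..1} y / 4 \<partial>lborel) \<partial>lborel)"
    by (subst nn_integral_unif_pair) auto
  also have "\<dots> = (\<integral>\<^sup>+x. (\<integral>\<^sup>+u. ?k x u * indicator A u \<partial>lborel) \<partial>lborel)"
  proof (rule nn_integral_cong_AE, rule AE_mp[OF AE_lborel_singleton[of 0]], intro AE_I2 impI)
    fix x :: real assume x: "x \<noteq> 0"
    have "(\<integral>\<^sup>+y. indicator A (x * (y - x)) * indicator {-1..1} x * indicator {-1..1} y / 4 \<partial>lborel)
       = ennreal \<bar>1 / x\<bar> * (\<integral>\<^sup>+u. indicator A (x * ((x + 1 / x * u) - x)) * indicator {-1..1} x * indicator {-1..1} (x + 1 / x * u) / 4 \<partial>lborel)"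
      by (rule nn_integral_real_affine) (use x in auto)
    also have "\<dots> = (\<integral>\<^sup>+u. ennreal \<bar>1 / x\<bar> * (indicator A (x * ((x + 1 / x * u) - x)) * indicator {-1..1} x * indicator {-1..1} (x + 1 / x * u) / 4) \<partial>lborel)"
      by (rule nn_integral_cmult[symmetric]) measurable
    also have "\<dots> = (\<integral>\<^sup>+u. ?k x u * indicator A u \<partial>lborel)"
    proof (rule nn_integral_cong)
      fix u
      have "ennreal \<bar>1 / x\<bar> / 4 = ennreal (1 / (4 * \<bar>x\<bar>))"
        using divide_ennreal[of "\<bar>1 / x\<bar>" 4] by simp
      then show "ennreal \<bar>1 / x\<bar> * (indicator A (x * ((x + 1 / x * u) - x)) * indicator {-1..1} x * indicator {-1..1} (x + 1 / x * u) / 4)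
        = ?k x u * indicator A u"
        using x by (auto simp: ennreal_times_divide split: split_indicator)
    qed
    finally show "(\<integral>\<^sup>+y. indicator A (x * (y - x)) * indicator {-1..1} x * indicator {-1..1} y / 4 \<partial>lborel) =
      (\<integral>\<^sup>+u. ?k x u * indicator A u \<partial>lborel)" .
  qed
  also have "\<dots> = (\<integral>\<^sup>+u. (\<integral>\<^sup>+x. ?k x u * indicator A u \<partial>lborel) \<partial>lborel)"
    by (rule lborel_pair.Fubini'[symmetric]) measurable
  also have "\<dots> = (\<integral>\<^sup>+u. (\<integral>\<^sup>+x. ?k x u \<partial>lborel) * indicator A u \<partial>lborel)"
    by (intro nn_integral_cong nn_integral_multc) measurable
  also have "\<dots> = (\<integral>\<^sup>+u. ennreal (excess_density u) * indicator A u \<partial>lborel)"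
  proof (rule nn_integral_cong_AE)
    have "AE u in lborel. u \<noteq> 0 \<and> u \<noteq> 1/4 \<and> u \<noteq> (-2::real)"
      by (intro AE_conjI AE_lborel_singleton)
    then show "AE u in lborel. (\<integral>\<^sup>+x. ?k x u \<partial>lborel) * indicator A u = ennreal (excess_density u) * indicator A u"
      by eventually_elim (simp add: nn_integral_excess_kernel)
  qed
  also have "\<dots> = emeasure (density lborel excess_density) A"
    by (simp add: emeasure_density)
  finally show "emeasure excess_law A = emeasure (density lborel excess_density) A" .
qed

section \<open>Monotonicity of the density ratio\<close>

text \<open>With \<open>r = sqrt (1 - 4 * u)\<close> and \<open>\<rho> = sqrt (1 + 4 * u)\<close> the two logarithms \<open>A\<close> and \<open>B\<close> have the
  derivatives \<open>-1 / (u * r)\<close> and \<open>-2 / (\<rho> * (\<rho> - 1))\<close>. So the derivative of \<open>A / B\<close> is negative if and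
  only if \<open>A * (2 * (u * r)) < B * (\<rho> * (\<rho> - 1))\<close>, and here each factor on the left is
  smaller than the corresponding one on the right.\<close>
lemma density_ratio_decreasing:
  assumes "0 < v" "v < w" "w < 1/4"
  shows "pos_density w / neg_density w < pos_density v / neg_density v"
proof -
  define A where "A = (\<lambda>u::real. ln ((1 + sqrt (1 - 4 * u)) / (1 - sqrt (1 - 4 * u))))"
  define B where "B = (\<lambda>u::real. ln (2 / (sqrt (1 + 4 * u) - 1)))"
  have eq: "pos_density u / neg_density u = A u / B u" if "0 < u" "u < 1/4" for u
    using that by (simp add: pos_density_def neg_density_def A_def B_def)
  have "A w / B w < A v / B v"
  proof (rule DERIV_neg_imp_decreasing[OF assms(2)])
    fix u assume "v \<le> u" "u \<le> w"
    then have u: "0 < u" "u < 1/4" using assms by auto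
    define r where "r = sqrt (1 - 4 * u)"
    define \<rho> where "\<rho> = sqrt (1 + 4 * u)"
    have r: "0 < r" "r < 1" "r\<^sup>2 = 1 - 4 * u" using u by (auto simp: r_def)
    have \<rho>: "1 < \<rho>" "\<rho>\<^sup>2 = 1 + 4 * u" using u by (auto simp: \<rho>_def)
    have dA: "(A has_real_derivative - 1 / (u * r)) (at u)"
    proof -
      have r': "((\<lambda>u. sqrt (1 - 4 * u)) has_real_derivative (- 2 / r)) (at u)"
        using u unfolding r_def by (auto intro!: derivative_eq_intros simp: field_simps)
      have "((\<lambda>r. ln ((1 + r) / (1 - r))) has_real_derivative 2 / (1 - r\<^sup>2)) (at r)"
        using r(1,2) abs_square_less_1[of r]
        by (auto intro!: derivative_eq_intros simp: divide_simps power2_eq_square)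
          (simp_all add: algebra_simps)
      then have "(A has_real_derivative 2 / (1 - r\<^sup>2) * (- 2 / r)) (at u)"
        unfolding A_def by (intro DERIV_chain2[OF _ r']) (simp add: r_def)
      also have "2 / (1 - r\<^sup>2) * (- 2 / r) = - 4 / (r * (1 - r\<^sup>2))" by simp
      also have "\<dots> = - 1 / (u * r)" using r by simp
      finally show ?thesis .
    qed
    have dB: "(B has_real_derivative - 2 / (\<rho> * (\<rho> - 1))) (at u)"
    proof -
      have \<rho>': "((\<lambda>u. sqrt (1 + 4 * u)) has_real_derivative (2 / \<rho>)) (at u)"
        using u unfolding \<rho>_def by (auto intro!: derivative_eq_intros simp: field_simps)
      have "((\<lambda>\<rho>. ln (2 / (\<rho> - 1))) has_real_derivative - 1 / (\<rho> - 1)) (at \<rho>)"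
        using \<rho>(1) by (auto intro!: derivative_eq_intros simp: divide_simps)
      then have "(B has_real_derivative - 1 / (\<rho> - 1) * (2 / \<rho>)) (at u)"
        unfolding B_def by (intro DERIV_chain2[OF _ \<rho>']) (simp add: \<rho>_def)
      also have "- 1 / (\<rho> - 1) * (2 / \<rho>) = - 2 / (\<rho> * (\<rho> - 1))"
        using \<rho> by (simp add: divide_simps)
      finally show ?thesis .
    qed
    have A0: "0 < A u" using pos_density_pos[of u] u by (simp add: pos_density_def A_def)
    have B0: "0 < B u" using neg_density_pos[of u] u by (simp add: neg_density_def B_def)
    \<comment> \<open>Because \<open>4 * u = (1 + r) * (1 - r) = (\<rho> + 1) * (\<rho> - 1)\<close>, the arguments of the logarithms are
      \<open>(1 + r)\<^sup>2 / (4 * u)\<close> and \<open>2 * (\<rho> + 1) / (4 * u)\<close>.\<close>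
    have AB: "A u < B u"
    proof -
      have "(1 + r)\<^sup>2 < 2\<^sup>2" using r by (intro power_strict_mono) auto
      also have "\<dots> < 2 * (\<rho> + 1)" using \<rho> by simp
      finally have "(1 + r)\<^sup>2 * (1 - r) * (\<rho> - 1) < 2 * (\<rho> + 1) * (1 - r) * (\<rho> - 1)"
        using r \<rho> by (intro mult_strict_right_mono) auto
      moreover have "(1 + r)\<^sup>2 * (1 - r) * (\<rho> - 1) = 4 * u * ((1 + r) * (\<rho> - 1))"
        using r by algebra
      moreover have "2 * (\<rho> + 1) * (1 - r) * (\<rho> - 1) = 4 * u * (2 * (1 - r))"
        using \<rho> by algebra
      ultimately have "(1 + r) * (\<rho> - 1) < 2 * (1 - r)" using u by simp
      then have "(1 + r) / (1 - r) < 2 / (\<rho> - 1)" using r \<rho> by (simp add: field_simps)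
      then show ?thesis unfolding A_def B_def using r \<rho> by (simp flip: r_def \<rho>_def)
    qed
    have "A u * (2 * (u * r)) < B u * (\<rho> * (\<rho> - 1))"
    proof -
      have "4 * u = (\<rho> + 1) * (\<rho> - 1)" using \<rho> by algebra
      then have "2 * (u * r) = (\<rho> + 1) / 2 * r * (\<rho> - 1)" by algebra
      also have "\<dots> < \<rho> * (\<rho> - 1)"
      proof -
        have "(\<rho> + 1) / 2 * r < (\<rho> + 1) / 2 * 1" using r \<rho> by (intro mult_strict_left_mono) auto
        also have "(\<rho> + 1) / 2 * 1 < \<rho>" using \<rho>(1) by simp
        finally have "(\<rho> + 1) / 2 * r < \<rho>" .
        then show ?thesis using \<rho>(1) by (intro mult_strict_right_mono) auto
      qed
      finally have "2 * (u * r) < \<rho> * (\<rho> - 1)" .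
      from mult_strict_mono[OF AB this B0] show ?thesis using u r by simp
    qed
    then have neg: "((- 1 / (u * r)) * B u - A u * (- 2 / (\<rho> * (\<rho> - 1)))) / (B u * B u) < 0"
      using u r \<rho> B0 by (simp add: field_simps)
    have "((\<lambda>u. A u / B u) has_real_derivative
        ((- 1 / (u * r)) * B u - A u * (- 2 / (\<rho> * (\<rho> - 1)))) / (B u * B u)) (at u)"
      using B0 by (intro DERIV_divide dA dB) auto
    with neg show "\<exists>y. ((\<lambda>u. A u / B u) has_real_derivative y) (at u) \<and> y < 0" by blast
  qed
  then show ?thesis using eq assms by simp
qed

text \<open>Monotonicity of the ratio in cross-multiplied form. It persists from \<open>w = 1/4\<close> on, the largest possible
  positive excess, because \<open>pos_density w\<close> vanishes there while \<open>neg_density w\<close> does not.\<close>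
lemma density_cross_strict:
  assumes "0 < v" "v < 1/4" "v < w" "w < 2"
  shows "pos_density w * neg_density v < pos_density v * neg_density w"
proof (cases "w < 1/4")
  case True
  have "0 < neg_density v" "0 < neg_density w" using assms by (auto intro: neg_density_pos)
  then show ?thesis using density_ratio_decreasing[of v w] assms True by (simp add: field_simps)
next
  case False
  then have "pos_density w = 0" by (simp add: pos_density_def)
  then show ?thesis using assms by (simp add: pos_density_pos neg_density_pos)
qed

lemma density_cross_le:
  assumes "0 < v" "v < w"
  shows "pos_density w * neg_density v \<le> pos_density v * neg_density w"
proof (cases "v < 1/4 \<and> w < 2")
  case True
  then show ?thesis using density_cross_strict[of v w] assms by simp
next
  case False
  then have "pos_density w = 0" using assms by (auto simp: pos_density_def)
  then show ?thesis by (simp add: pos_density_nonneg neg_density_nonneg)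
qed

section \<open>A linear combination of two independent excesses\<close>

lemma Collect_in_borel_pair:
  fixes P :: "real \<times> real \<Rightarrow> bool"
  assumes "Measurable.pred (borel \<Otimes>\<^sub>M borel) P"
  shows "{z. P z} \<in> sets (borel \<Otimes>\<^sub>M borel)"
  using assms by (simp add: pred_def space_pair_measure)

lemma sets_excess_pairI: "P \<in> sets (borel \<Otimes>\<^sub>M borel) \<Longrightarrow> P \<in> sets (excess_law \<Otimes>\<^sub>M excess_law)"
  by (simp cong: sets_pair_measure_cong)

definition excess_prob :: "real \<Rightarrow> real" where
  "excess_prob l = measure (excess_law \<Otimes>\<^sub>M excess_law) {z. 0 < fst z + l * snd z}"

text \<open>Divide \<open>X + l * Y > 0\<close> by \<open>l\<close> and exchange the independent copies \<open>X\<close> and \<open>Y\<close>.\<close>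
lemma excess_prob_inverse:
  assumes "0 < l"
  shows "excess_prob (1 / l) = excess_prob l"
proof -
  let ?M = "excess_law \<Otimes>\<^sub>M excess_law"
  have *: "{z. 0 < fst z + l * snd z} \<in> sets (borel \<Otimes>\<^sub>M borel)"
    by (intro Collect_in_borel_pair) measurable
  have "measure ?M {z. 0 < fst z + l * snd z} =
      measure (distr ?M ?M (\<lambda>(x, y). (y, x))) {z. 0 < fst z + l * snd z}"
    by (simp flip: excess_pair.distr_pair_swap)
  also have "\<dots> = measure ?M {z. 0 < snd z + l * fst z}"
    using * by (subst measure_distr) (auto simp: space_pair_measure case_prod_unfold vimage_def)
  also have "{z. 0 < snd z + l * fst z} = {z. 0 < fst z + 1 / l * snd z}"
    using assms by (auto simp: field_simps)
  finally show ?thesis by (simp add: excess_prob_def)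
qed

lemma emeasure_excess_pair:
  assumes [measurable]: "A \<in> sets (borel \<Otimes>\<^sub>M borel)"
  shows "emeasure (excess_law \<Otimes>\<^sub>M excess_law) A =
    (\<integral>\<^sup>+y. (\<integral>\<^sup>+x. ennreal (excess_density x) * ennreal (excess_density y) * indicator A (x, y) \<partial>lborel) \<partial>lborel)"
proof -
  have "emeasure (excess_law \<Otimes>\<^sub>M excess_law) A = (\<integral>\<^sup>+z. indicator A z \<partial>(excess_law \<Otimes>\<^sub>M excess_law))"
    by simp
  also have "\<dots> = (\<integral>\<^sup>+y. (\<integral>\<^sup>+x. indicator A (x, y) \<partial>excess_law) \<partial>excess_law)"
    by (rule excess_pair.nn_integral_snd[symmetric]) measurable
  also have "\<dots> = (\<integral>\<^sup>+y. ennreal (excess_density y) * (\<integral>\<^sup>+x. ennreal (excess_density x) * indicator A (x, y) \<partial>lborel) \<partial>lborel)"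
    unfolding excess_law_eq_density by (simp add: nn_integral_density)
  also have "\<dots> = (\<integral>\<^sup>+y. (\<integral>\<^sup>+x. ennreal (excess_density x) * ennreal (excess_density y) * indicator A (x, y) \<partial>lborel) \<partial>lborel)"
    by (simp add: nn_integral_cmult[symmetric] mult_ac)
  finally show ?thesis .
qed

text \<open>If \<open>X + l * Y\<close> is not positive but \<open>X + l' * Y\<close> is, then \<open>(l' - l) * Y > 0\<close>, so that \<open>Y = v > 0\<close>
  and \<open>X = -w < 0\<close>. For the reverse change of sign it is \<open>Y = -v\<close> that is negative and \<open>X = w\<close> that is
  positive. In terms of \<open>v\<close> and \<open>w\<close>, both events then range over the same wedge, apart from its boundary
  rays, which makes their probabilities comparable pointwise.\<close>
lemma emeasure_excess_gain:
  assumes "0 < l" "l < l'"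
  shows "emeasure (excess_law \<Otimes>\<^sub>M excess_law) {z. 0 < fst z + l' * snd z \<and> \<not> 0 < fst z + l * snd z} =
    (\<integral>\<^sup>+v. (\<integral>\<^sup>+w. ennreal (pos_density v * neg_density w) * of_bool (0 < v \<and> l * v \<le> w \<and> w < l' * v) \<partial>lborel) \<partial>lborel)"
    (is "emeasure _ ?A = _")
proof -
  have [measurable]: "?A \<in> sets (borel \<Otimes>\<^sub>M borel)" by (rule Collect_in_borel_pair) measurable
  have "emeasure (excess_law \<Otimes>\<^sub>M excess_law) ?A =
    (\<integral>\<^sup>+v. (\<integral>\<^sup>+x. ennreal (excess_density x) * ennreal (excess_density v) * indicator ?A (x, v) \<partial>lborel) \<partial>lborel)"
    by (rule emeasure_excess_pair) measurable
  also have "\<dots> = (\<integral>\<^sup>+v. (\<integral>\<^sup>+w. ennreal (excess_density (- w)) * ennreal (excess_density v) * indicator ?A (- w, v) \<partial>lborel) \<partial>lborel)"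
    by (rule nn_integral_cong, subst nn_integral_real_affine[where c="-1" and t=0]) auto
  also have "\<dots> = (\<integral>\<^sup>+v. (\<integral>\<^sup>+w. ennreal (pos_density v * neg_density w) * of_bool (0 < v \<and> l * v \<le> w \<and> w < l' * v) \<partial>lborel) \<partial>lborel)"
  proof (intro nn_integral_cong)
    fix v w
    have "0 < v" if "w < l' * v" "l * v \<le> w"
    proof -
      from that have "0 < (l' - l) * v" by (simp add: algebra_simps)
      then show ?thesis using assms by (simp add: zero_less_mult_iff)
    qed
    moreover have "0 < w" if "0 < v" "l * v \<le> w"
      using that assms mult_pos_pos[of l v] by linarith
    ultimately show "ennreal (excess_density (- w)) * ennreal (excess_density v) * indicator ?A (- w, v) =
      ennreal (pos_density v * neg_density w) * of_bool (0 < v \<and> l * v \<le> w \<and> w < l' * v)"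
      by (auto simp: excess_density_pos excess_density_neg ennreal_mult pos_density_nonneg
        neg_density_nonneg mult.commute not_less split: split_indicator)
  qed
  finally show ?thesis .
qed

lemma emeasure_excess_loss:
  assumes "0 < l" "l < l'"
  shows "emeasure (excess_law \<Otimes>\<^sub>M excess_law) {z. 0 < fst z + l * snd z \<and> \<not> 0 < fst z + l' * snd z} =
    (\<integral>\<^sup>+v. (\<integral>\<^sup>+w. ennreal (pos_density w * neg_density v) * of_bool (0 < v \<and> l * v < w \<and> w \<le> l' * v) \<partial>lborel) \<partial>lborel)"
    (is "emeasure _ ?A = _")
proof -
  have [measurable]: "?A \<in> sets (borel \<Otimes>\<^sub>M borel)" by (rule Collect_in_borel_pair) measurable
  have "emeasure (excess_law \<Otimes>\<^sub>M excess_law) ?A =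
    (\<integral>\<^sup>+y. (\<integral>\<^sup>+w. ennreal (excess_density w) * ennreal (excess_density y) * indicator ?A (w, y) \<partial>lborel) \<partial>lborel)"
    by (rule emeasure_excess_pair) measurable
  also have "\<dots> = (\<integral>\<^sup>+v. (\<integral>\<^sup>+w. ennreal (excess_density w) * ennreal (excess_density (- v)) * indicator ?A (w, - v) \<partial>lborel) \<partial>lborel)"
    by (subst nn_integral_real_affine[where c="-1" and t=0]) auto
  also have "\<dots> = (\<integral>\<^sup>+v. (\<integral>\<^sup>+w. ennreal (pos_density w * neg_density v) * of_bool (0 < v \<and> l * v < w \<and> w \<le> l' * v) \<partial>lborel) \<partial>lborel)"
  proof (intro nn_integral_cong)
    fix v w
    have "0 < v" if "w \<le> l' * v" "l * v < w"
    proof -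
      from that have "0 < (l' - l) * v" by (simp add: algebra_simps)
      then show ?thesis using assms by (simp add: zero_less_mult_iff)
    qed
    moreover have "0 < w" if "0 < v" "l * v < w"
      using that assms mult_pos_pos[of l v] by linarith
    ultimately show "ennreal (excess_density w) * ennreal (excess_density (- v)) * indicator ?A (w, - v) =
      ennreal (pos_density w * neg_density v) * of_bool (0 < v \<and> l * v < w \<and> w \<le> l' * v)"
      by (auto simp: excess_density_pos excess_density_neg ennreal_mult pos_density_nonneg
        neg_density_nonneg not_less split: split_indicator)
  qed
  finally show ?thesis .
qed

lemma AE_notin_interval_imp_empty:
  fixes a b :: real
  assumes "AE x in lborel. x \<notin> {a<..<b}"
  shows "b \<le> a"
proof (rule ccontr)
  assume "\<not> b \<le> a"
  moreover have "{a<..<b} \<in> null_sets lborel" using assms by (subst AE_iff_null_sets) auto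
  ultimately show False by (auto dest!: null_setsD1)
qed

text \<open>Inside the wedge the comparison of the two integrands is strict where \<open>v < 1/4\<close> and \<open>w < 2\<close>. For
  \<open>v < m = min (1/4) (2 / l')\<close> this covers the whole section \<open>l * v < w < l' * v\<close> of the wedge, which makes
  the inner integrals strictly ordered for a set of \<open>v\<close> of positive measure.\<close>
lemma excess_loss_less_gain:
  assumes "1 \<le> l" "l < l'"
  shows "emeasure (excess_law \<Otimes>\<^sub>M excess_law) {z. 0 < fst z + l * snd z \<and> \<not> 0 < fst z + l' * snd z}
    < emeasure (excess_law \<Otimes>\<^sub>M excess_law) {z. 0 < fst z + l' * snd z \<and> \<not> 0 < fst z + l * snd z}"
proof -
  let ?loss = "\<lambda>v w. ennreal (pos_density w * neg_density v) * of_bool (0 < v \<and> l * v < w \<and> w \<le> l' * v)"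
  let ?gain = "\<lambda>v w. ennreal (pos_density v * neg_density w) * of_bool (0 < v \<and> l * v \<le> w \<and> w < l' * v)"
  have [measurable]: "(\<lambda>z. ?loss (fst z) (snd z)) \<in> borel_measurable (borel \<Otimes>\<^sub>M borel)"
    "(\<lambda>z. ?gain (fst z) (snd z)) \<in> borel_measurable (borel \<Otimes>\<^sub>M borel)"
    by measurable
  note l = \<open>1 \<le> l\<close> \<open>l < l'\<close>
  have ae: "AE w in lborel. w \<noteq> l' * v" for v by (rule AE_lborel_singleton)
  \<comment> \<open>On the ray \<open>w = l' * v\<close> the indicator of the loss is \<open>1\<close> and that of the gain is \<open>0\<close>,
    so the comparison may fail on this null set.\<close>
  have pointwise: "?loss v w \<le> ?gain v w" if "w \<noteq> l' * v" for v w
  proof (cases "0 < v \<and> l * v < w \<and> w < l' * v")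
    case True
    then have "v < w" using l mult_right_mono[of 1 l v] by linarith
    then show ?thesis using True density_cross_le[of v w] by (simp add: ennreal_leI)
  next
    case False
    then show ?thesis using that by auto
  qed
  have le: "(\<integral>\<^sup>+w. ?loss v w \<partial>lborel) \<le> (\<integral>\<^sup>+w. ?gain v w \<partial>lborel)" for v
    by (rule nn_integral_mono_AE, rule eventually_mono[OF ae[of v]], rule pointwise)
  have fin: "(\<integral>\<^sup>+v. (\<integral>\<^sup>+w. ?loss v w \<partial>lborel) \<partial>lborel) \<noteq> \<infinity>"
    using l by (subst emeasure_excess_loss[symmetric]) auto
  have strict: "(\<integral>\<^sup>+w. ?loss v w \<partial>lborel) < (\<integral>\<^sup>+w. ?gain v w \<partial>lborel)"
    if v: "0 < v" "v < 1/4" "l' * v < 2" "(\<integral>\<^sup>+w. ?loss v w \<partial>lborel) \<noteq> \<infinity>" for v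
  proof (rule nn_integral_less)
    show "(\<lambda>w. ?loss v w) \<in> borel_measurable lborel" "(\<lambda>w. ?gain v w) \<in> borel_measurable lborel"
      by measurable
    show "AE w in lborel. ?loss v w \<le> ?gain v w" 
      by (rule eventually_mono[OF ae[of v]], rule pointwise)
    show "\<not> (AE w in lborel. ?gain v w \<le> ?loss v w)"
    proof
      assume *: "AE w in lborel. ?gain v w \<le> ?loss v w"
      have "AE w in lborel. w \<notin> {l * v<..<l' * v}"
        using *
      proof eventually_elim
        fix w assume gl: "?gain v w \<le> ?loss v w"
        show "w \<notin> {l * v<..<l' * v}"
        proof
          assume w: "w \<in> {l * v<..<l' * v}"
          have "1 * v \<le> l * v" using l v by (intro mult_right_mono) auto
          then have "v < w" using w unfolding greaterThanLessThan_iff by linarith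
          then have "pos_density w * neg_density v < pos_density v * neg_density w"
            using v w by (intro density_cross_strict) auto
          moreover have "pos_density v * neg_density w \<le> pos_density w * neg_density v"
            using gl w v by (simp add: ennreal_le_iff pos_density_nonneg neg_density_nonneg)
          ultimately show False by simp
        qed
      qed
      then have "l' * v \<le> l * v" by (rule AE_notin_interval_imp_empty)
      moreover have "l * v < l' * v" using l v by simp
      ultimately show False by simp
    qed
  qed (use v in auto)
  define m where "m = min (1/4) (2 / l')"
  have m: "0 < m" using l by (simp add: m_def)
  have "(\<integral>\<^sup>+v. (\<integral>\<^sup>+w. ?loss v w \<partial>lborel) \<partial>lborel) < (\<integral>\<^sup>+v. (\<integral>\<^sup>+w. ?gain v w \<partial>lborel) \<partial>lborel)"
  proof (rule nn_integral_less)
    show L[measurable]: "(\<lambda>v. \<integral>\<^sup>+w. ?loss v w \<partial>lborel) \<in> borel_measurable lborel"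
      "(\<lambda>v. \<integral>\<^sup>+w. ?gain v w \<partial>lborel) \<in> borel_measurable lborel"
      by measurable
    show "\<not> (AE v in lborel. (\<integral>\<^sup>+w. ?gain v w \<partial>lborel) \<le> (\<integral>\<^sup>+w. ?loss v w \<partial>lborel))"
    proof
      assume "AE v in lborel. (\<integral>\<^sup>+w. ?gain v w \<partial>lborel) \<le> (\<integral>\<^sup>+w. ?loss v w \<partial>lborel)"
      moreover have "AE v in lborel. (\<integral>\<^sup>+w. ?loss v w \<partial>lborel) \<noteq> \<infinity>"
        by (rule nn_integral_noteq_infinite[OF L(1) fin])
      ultimately have "AE v in lborel. v \<notin> {0<..<m}"
      proof eventually_elim
        fix v assume v: "(\<integral>\<^sup>+w. ?gain v w \<partial>lborel) \<le> (\<integral>\<^sup>+w. ?loss v w \<partial>lborel)"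
          "(\<integral>\<^sup>+w. ?loss v w \<partial>lborel) \<noteq> \<infinity>"
        show "v \<notin> {0<..<m}"
        proof
          assume "v \<in> {0<..<m}"
          then have "0 < v" "v < 1/4" "l' * v < 2" using l by (auto simp: m_def field_simps)
          from strict[OF this v(2)] v(1) show False by simp
        qed
      qed
      then have "m \<le> 0" by (rule AE_notin_interval_imp_empty)
      then show False using m by simp
    qed
  qed (use le fin in auto)
  then show ?thesis
    using emeasure_excess_loss[of l l'] emeasure_excess_gain[of l l'] l by simp
qed

lemma excess_prob_strict_mono:
  assumes "1 \<le> l" "l < l'"
  shows "excess_prob l < excess_prob l'"
proof -
  let ?M = "excess_law \<Otimes>\<^sub>M excess_law"
  let ?P = "\<lambda>l z. 0 < fst z + l * snd z"
  have sets: "{z. ?P l z \<and> ?P l' z} \<in> sets ?M" "{z. ?P l z \<and> \<not> ?P l' z} \<in> sets ?M" for l l'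
    by (intro sets_excess_pairI Collect_in_borel_pair; measurable)+
  have split: "excess_prob l = measure ?M {z. ?P l z \<and> ?P l' z} + measure ?M {z. ?P l z \<and> \<not> ?P l' z}" for l l'
    unfolding excess_prob_def
    by (subst excess_pair.finite_measure_Union[symmetric, OF sets]) (auto intro!: arg_cong[where f="measure ?M"])
  have "measure ?M {z. ?P l z \<and> \<not> ?P l' z} < measure ?M {z. ?P l' z \<and> \<not> ?P l z}"
    using excess_loss_less_gain[OF assms]
    by (simp add: excess_pair.emeasure_eq_measure ennreal_less_iff)
  moreover have "{z. ?P l z \<and> ?P l' z} = {z. ?P l' z \<and> ?P l z}" by auto
  ultimately show ?thesis using split[of l l'] split[of l' l] by simp
qed

section \<open>The projection probability\<close>

text \<open>Two independent points in the square, with coordinates \<open>(x, s)\<close> and \<open>(y, t)\<close>, amount to two independent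
  pairs \<open>(x, y)\<close> and \<open>(s, t)\<close>, one for each side direction; Fubini's theorem does the regrouping.\<close>
lemma excess_pair_eq_distr:
  "excess_law \<Otimes>\<^sub>M excess_law =
    distr ((unif \<Otimes>\<^sub>M unif) \<Otimes>\<^sub>M (unif \<Otimes>\<^sub>M unif)) (borel \<Otimes>\<^sub>M borel)
      (\<lambda>((x, s), (y, t)). (x * (y - x), s * (t - s)))" (is "_ = distr (?U \<Otimes>\<^sub>M ?U) _ ?h")
proof (rule measure_eqI)
  show "sets (excess_law \<Otimes>\<^sub>M excess_law) = sets (distr (?U \<Otimes>\<^sub>M ?U) (borel \<Otimes>\<^sub>M borel) ?h)"
    by (simp cong: sets_pair_measure_cong)
  fix P assume P0: "P \<in> sets (excess_law \<Otimes>\<^sub>M excess_law)"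
  then have P[measurable]: "P \<in> sets (borel \<Otimes>\<^sub>M borel)" by (simp cong: sets_pair_measure_cong)
  have iterated: "(\<integral>\<^sup>+z. f z \<partial>(?U \<Otimes>\<^sub>M ?U)) =
      (\<integral>\<^sup>+x. (\<integral>\<^sup>+s. (\<integral>\<^sup>+y. (\<integral>\<^sup>+t. f ((x, s), (y, t)) \<partial>unif) \<partial>unif) \<partial>unif) \<partial>unif)"
    if [measurable]: "f \<in> borel_measurable (?U \<Otimes>\<^sub>M ?U)" for f :: "(real \<times> real) \<times> (real \<times> real) \<Rightarrow> ennreal"
  proof -
    have "(\<integral>\<^sup>+z. f z \<partial>(?U \<Otimes>\<^sub>M ?U)) = (\<integral>\<^sup>+a. (\<integral>\<^sup>+b. f (a, b) \<partial>?U) \<partial>?U)"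
      by (rule unif_pair.nn_integral_fst[symmetric]) measurable
    also have "\<dots> = (\<integral>\<^sup>+a. (\<integral>\<^sup>+y. (\<integral>\<^sup>+t. f (a, (y, t)) \<partial>unif) \<partial>unif) \<partial>?U)"
      by (rule nn_integral_cong, rule unif.nn_integral_fst[symmetric]) measurable
    also have "\<dots> = (\<integral>\<^sup>+x. (\<integral>\<^sup>+s. (\<integral>\<^sup>+y. (\<integral>\<^sup>+t. f ((x, s), (y, t)) \<partial>unif) \<partial>unif) \<partial>unif) \<partial>unif)"
      by (rule unif.nn_integral_fst[symmetric]) measurable
    finally show ?thesis .
  qed
  \<comment> \<open>The two sides are the images of the same measure under \<open>?k\<close> and \<open>?h\<close>, which differ by exchanging
    the middle two of the four variables.\<close>
  let ?k = "\<lambda>(z, w). (case z of (x, y) \<Rightarrow> x * (y - x), case w of (s, t) \<Rightarrow> s * (t - s)) :: real \<times> real"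
  have h[measurable]: "?h \<in> ?U \<Otimes>\<^sub>M ?U \<rightarrow>\<^sub>M borel \<Otimes>\<^sub>M borel"
    unfolding case_prod_unfold by measurable
  have k[measurable]: "?k \<in> ?U \<Otimes>\<^sub>M ?U \<rightarrow>\<^sub>M borel \<Otimes>\<^sub>M borel"
    unfolding case_prod_unfold by measurable
  have e[measurable]: "(\<lambda>(x, y). x * (y - x) :: real) \<in> ?U \<rightarrow>\<^sub>M borel"
    unfolding case_prod_unfold by measurable
  have Pk: "(\<lambda>z. indicator P (?k z) :: ennreal) \<in> borel_measurable (?U \<Otimes>\<^sub>M ?U)"
    by (rule measurable_compose[OF k]) measurable
  have Ph: "(\<lambda>z. indicator P (?h z) :: ennreal) \<in> borel_measurable (?U \<Otimes>\<^sub>M ?U)"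
    by (rule measurable_compose[OF h]) measurable
  have sf: "sigma_finite_measure (distr ?U borel (\<lambda>(x, y). x * (y - x)))"
    unfolding excess_law_def[symmetric] ..
  have "excess_law \<Otimes>\<^sub>M excess_law = distr (?U \<Otimes>\<^sub>M ?U) (borel \<Otimes>\<^sub>M borel) ?k"
    unfolding excess_law_def by (rule pair_measure_distr[OF e e sf])
  then have "emeasure (excess_law \<Otimes>\<^sub>M excess_law) P = (\<integral>\<^sup>+z. indicator P z \<partial>distr (?U \<Otimes>\<^sub>M ?U) (borel \<Otimes>\<^sub>M borel) ?k)"
    by simp
  also have "\<dots> = (\<integral>\<^sup>+z. indicator P (?k z) \<partial>(?U \<Otimes>\<^sub>M ?U))"
    by (rule nn_integral_distr[OF k]) measurable
  also have "\<dots> = (\<integral>\<^sup>+x. (\<integral>\<^sup>+y. (\<integral>\<^sup>+s. (\<integral>\<^sup>+t. indicator P (x * (y - x), s * (t - s)) \<partial>unif) \<partial>unif) \<partial>unif) \<partial>unif)"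
    unfolding iterated[OF Pk] by (simp only: prod.case)
  also have "\<dots> = (\<integral>\<^sup>+x. (\<integral>\<^sup>+s. (\<integral>\<^sup>+y. (\<integral>\<^sup>+t. indicator P (x * (y - x), s * (t - s)) \<partial>unif) \<partial>unif) \<partial>unif) \<partial>unif)"
    by (rule nn_integral_cong, rule unif_pair.Fubini') measurable
  also have "\<dots> = (\<integral>\<^sup>+z. indicator P (?h z) \<partial>(?U \<Otimes>\<^sub>M ?U))"
    unfolding iterated[OF Ph] by (simp only: prod.case)
  also have "\<dots> = (\<integral>\<^sup>+z. indicator P z \<partial>distr (?U \<Otimes>\<^sub>M ?U) (borel \<Otimes>\<^sub>M borel) ?h)"
    by (rule nn_integral_distr[OF h, symmetric]) measurable
  also have "\<dots> = emeasure (distr (?U \<Otimes>\<^sub>M ?U) (borel \<Otimes>\<^sub>M borel) ?h) P"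
    by simp
  finally show "emeasure (excess_law \<Otimes>\<^sub>M excess_law) P = emeasure (distr (?U \<Otimes>\<^sub>M ?U) (borel \<Otimes>\<^sub>M borel) ?h) P" .
qed

text \<open>The function \<open>G\<close> is \<open>(p1 - c) \<bullet> (p2 - p1)\<close> in coordinates. Exchanging the two points turns \<open>G > 0\<close> into the
  other event in which the foot of the perpendicular misses the segment.\<close>
lemma proj_prob_eq_excess_prob:
  assumes rect: "is_rectangle c 2 (2 * a) R" and a: "0 < a"
  shows "proj_prob R c = 1 - 2 * excess_prob (a\<^sup>2)"
proof -
  let ?U = "unif \<Otimes>\<^sub>M unif"
  let ?M = "?U \<Otimes>\<^sub>M ?U"
  obtain u v where uv: "norm u = 1" "norm v = 1" "orthogonal u v"
    and R: "R = {c + s *\<^sub>R u + t *\<^sub>R v | s t. \<bar>s\<bar> \<le> 1 \<and> \<bar>t\<bar> \<le> a}"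
    using rect by (auto simp: is_rectangle_def)
  have uv': "u \<bullet> u = 1" "v \<bullet> v = 1" "u \<bullet> v = 0" "v \<bullet> u = 0"
    using uv by (simp_all add: norm_eq_1 orthogonal_def inner_commute)
  define \<phi> where "\<phi> = (\<lambda>z. c + fst z *\<^sub>R u + (a * snd z) *\<^sub>R v)"
  have \<phi>[measurable]: "\<phi> \<in> ?U \<rightarrow>\<^sub>M borel" unfolding \<phi>_def by measurable
  have unif_R: "uniform_measure lborel R = distr ?U borel \<phi>"
    unfolding R \<phi>_def by (rule uniform_measure_rectangle[OF uv a])
  interpret unif_R: prob_space "distr ?U borel \<phi>" by (rule unif_pair.prob_space_distr[OF \<phi>])
  interpret M: pair_prob_space ?U ?U ..
  let ?\<Phi> = "\<lambda>(z, w). (\<phi> z, \<phi> w)"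
  have \<Phi>[measurable]: "?\<Phi> \<in> ?M \<rightarrow>\<^sub>M borel \<Otimes>\<^sub>M borel" unfolding case_prod_unfold by measurable
  have pair: "uniform_measure lborel R \<Otimes>\<^sub>M uniform_measure lborel R = distr ?M (borel \<Otimes>\<^sub>M borel) ?\<Phi>"
    unfolding unif_R by (rule pair_measure_distr[OF \<phi> \<phi>]) unfold_locales
  define G :: "(real \<times> real) \<times> (real \<times> real) \<Rightarrow> real"
    where "G = (\<lambda>((x, s), (y, t)). x * (y - x) + a\<^sup>2 * (s * (t - s)))"
  have G[measurable]: "G \<in> borel_measurable ?M"
    unfolding G_def case_prod_unfold by measurable
  let ?sw = "\<lambda>(z, w). (w, z) :: (real \<times> real) \<times> (real \<times> real)"
  let ?A = "{z. 0 < G z}" and ?B = "{z. 0 < G (?sw z)}"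
  have A: "?A \<in> sets ?M"
  proof -
    have "{z \<in> space ?M. 0 < G z} \<in> sets ?M" by measurable
    then show ?thesis by (simp add: space_pair_measure)
  qed
  have sw: "?sw \<in> ?M \<rightarrow>\<^sub>M ?M" by measurable
  have B: "?B = ?sw -` ?A \<inter> space ?M" by (auto simp: space_pair_measure)
  have B_sets: "?B \<in> sets ?M" unfolding B by (rule measurable_sets[OF sw A])
  have mA: "measure ?M ?A = excess_prob (a\<^sup>2)"
  proof -
    let ?h = "\<lambda>((x, s), (y, t)). (x * (y - x), s * (t - s)) :: real \<times> real"
    have "?h \<in> ?M \<rightarrow>\<^sub>M borel \<Otimes>\<^sub>M borel" unfolding case_prod_unfold by measurable
    moreover have "{z. 0 < fst z + a\<^sup>2 * snd z} \<in> sets (borel \<Otimes>\<^sub>M borel)"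
      by (rule Collect_in_borel_pair) measurable
    ultimately have "excess_prob (a\<^sup>2) = measure ?M (?h -` {z. 0 < fst z + a\<^sup>2 * snd z} \<inter> space ?M)"
      unfolding excess_prob_def excess_pair_eq_distr by (rule measure_distr)
    also have "?h -` {z. 0 < fst z + a\<^sup>2 * snd z} \<inter> space ?M = ?A"
      by (auto simp: G_def space_pair_measure)
    finally show ?thesis ..
  qed
  have mB: "measure ?M ?B = measure ?M ?A"
    unfolding B measure_distr[OF sw A, symmetric] M.distr_pair_swap[symmetric] ..
  have disj: "?A \<inter> ?B = {}"
  proof -
    have "G z + G (?sw z) \<le> 0" for z
    proof -
      obtain x s y t where z: "z = ((x, s), (y, t))" by (metis surj_pair)
      have "G z + G (?sw z) = - ((x - y)\<^sup>2 + a\<^sup>2 * (s - t)\<^sup>2)"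
        by (simp add: G_def z power2_eq_square algebra_simps)
      moreover have "0 \<le> (x - y)\<^sup>2 + a\<^sup>2 * (s - t)\<^sup>2" by simp
      ultimately show ?thesis by linarith
    qed
    then have "\<not> (0 < G z \<and> 0 < G (?sw z))" for z using add_pos_pos not_less by blast
    then show ?thesis by blast
  qed
  let ?E = "{(p1, p2). orth_proj (affine hull {p1, p2}) c \<in> closed_segment p1 p2}"
  have E: "?E = {z. 0 \<le> (fst z - c) \<bullet> (fst z - snd z) \<and> 0 \<le> (snd z - c) \<bullet> (snd z - fst z)}"
    by (auto simp: orth_proj_in_closed_segment_iff)
  have E_sets: "?E \<in> sets (borel \<Otimes>\<^sub>M borel)"
    unfolding E borel_prod by (intro borel_closed closed_Collect_conj closed_Collect_le continuous_intros)
  have "proj_prob R c = measure ?M (?\<Phi> -` ?E \<inter> space ?M)"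
    unfolding proj_prob_def pair by (rule measure_distr[OF \<Phi> E_sets])
  also have "?\<Phi> -` ?E \<inter> space ?M = space ?M - (?A \<union> ?B)"
  proof -
    have "(\<phi> z - c) \<bullet> (\<phi> z - \<phi> w) = - G (z, w)" for z w
      by (simp add: \<phi>_def G_def case_prod_unfold inner_simps uv' power2_eq_square algebra_simps)
    then show ?thesis unfolding E by (auto simp: space_pair_measure not_less)
  qed
  also have "measure ?M \<dots> = 1 - measure ?M (?A \<union> ?B)"
    using A B_sets by (intro M.prob_compl) auto
  also have "measure ?M (?A \<union> ?B) = measure ?M ?A + measure ?M ?B"
    by (rule M.finite_measure_Union[OF A B_sets disj])
  finally show ?thesis by (simp add: mA mB)
qed

lemma unimodal_if_strict_mono_antimono:
  fixes p :: "real \<Rightarrow> real"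
  assumes inc: "\<And>a b. 0 < a \<Longrightarrow> a < b \<Longrightarrow> b \<le> 1 \<Longrightarrow> p a < p b"
    and dec: "\<And>a b. 1 \<le> a \<Longrightarrow> a < b \<Longrightarrow> p b < p a"
  shows "quasiconcave_on {0<..} p \<and> (\<forall>a>0. (\<forall>b>0. p b \<le> p a) \<longleftrightarrow> a = 1)"
proof -
  have max1: "p b \<le> p 1" if "0 < b" for b
    using inc[of b 1] dec[of 1 b] that by (cases b "1::real" rule: linorder_cases) auto
  have at_open: "(\<forall>\<^sub>F y in at x within {0<..}. P y) \<longleftrightarrow> (\<exists>d>0. \<forall>y>0. y \<noteq> x \<and> dist y x < d \<longrightarrow> P y)" for x :: real and P
    by (auto simp: eventually_at)
  have near_left: "\<exists>y. z < y \<and> y < x \<and> dist y x < d" if "0 < d" "z < x" for x z d :: real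
    using that by (intro exI[of _ "max ((x + z) / 2) (x - d / 2)"]) (auto simp: dist_real_def max_def field_simps)
  have near_right: "\<exists>y. x < y \<and> y < z \<and> dist y x < d" if "0 < d" "x < z" for x z d :: real
    using that by (intro exI[of _ "min ((x + z) / 2) (x + d / 2)"]) (auto simp: dist_real_def min_def field_simps)
  have "local_max_on {0<..} p 1"
    using max1 by (auto simp: local_max_on_def eventually_at intro!: exI[of _ 1])
  moreover have "x = 1" if "local_max_on {0<..} p x" for x
  proof (rule ccontr)
    assume "x \<noteq> 1"
    from that obtain d where x: "0 < x" and d: "0 < d" "\<And>y. 0 < y \<Longrightarrow> y \<noteq> x \<Longrightarrow> dist y x < d \<Longrightarrow> p y \<le> p x"
      by (auto simp: local_max_on_def at_open)
    show False
    proof (cases "x < 1")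
      case True
      then obtain y where "x < y" "y < 1" "dist y x < d" using near_right[OF d(1)] by blast
      then show False using inc[of x y] d(2)[of y] x by auto
    next
      case False
      then have "1 < x" using \<open>x \<noteq> 1\<close> by simp
      then obtain y where "1 < y" "y < x" "dist y x < d" using near_left[OF d(1)] by blast
      then show False using dec[of y x] d(2)[of y] by auto
    qed
  qed
  moreover have "\<not> local_min_on {0<..} p x" for x
  proof
    assume "local_min_on {0<..} p x"
    then obtain d where x: "0 < x" and d: "0 < d" "\<And>y. 0 < y \<Longrightarrow> y \<noteq> x \<Longrightarrow> dist y x < d \<Longrightarrow> p x \<le> p y"
      by (auto simp: local_min_on_def at_open)
    show False
    proof (cases "x \<le> 1")
      case True
      obtain y where "0 < y" "y < x" "dist y x < d" using near_left[OF d(1) x] by blast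
      then show False using inc[of y x] d(2)[of y] True by auto
    next
      case False
      obtain y where "x < y" "dist y x < d" using near_right[OF d(1), of x "x + 1"] by auto
      then show False using dec[of x y] d(2)[of y] x False by auto
    qed
  qed
  moreover have "is_interval ({0<..} :: real set)" by simp
  ultimately have "quasiconcave_on {0<..} p" unfolding quasiconcave_on_def by blast
  moreover have "a = 1" if "0 < a" "\<forall>b>0. p b \<le> p a" for a
    using that(2)[rule_format, of 1] inc[of a 1] dec[of 1 a] \<open>0 < a\<close>
    by (cases a "1::real" rule: linorder_cases) auto
  ultimately show ?thesis using max1 by blast
qed

theorem theorem9:
  fixes R :: "real \<Rightarrow> (real^2) set" and c :: "real \<Rightarrow> real^2"
  assumes "\<And>a. a > 0 \<Longrightarrow> is_rectangle (c a) 2 (2 * a) (R a)"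
  shows "let p = (\<lambda>a. proj_prob (R a) (c a)) in
           quasiconcave_on {0<..} p \<and>
           (\<forall>a>0. (\<forall>b>0. p b \<le> p a) \<longleftrightarrow> a = 1)"
proof -
  have p: "proj_prob (R a) (c a) = 1 - 2 * excess_prob (a\<^sup>2)" if "0 < a" for a
    using proj_prob_eq_excess_prob[OF assms[OF that] that] .
  have dec: "proj_prob (R b) (c b) < proj_prob (R a) (c a)" if "1 \<le> a" "a < b" for a b
  proof -
    have "1 \<le> a\<^sup>2" "a\<^sup>2 < b\<^sup>2" using that by (auto intro: power_strict_mono)
    then show ?thesis using excess_prob_strict_mono that by (simp add: p)
  qed
  have inv: "proj_prob (R (1 / a)) (c (1 / a)) = proj_prob (R a) (c a)" if "0 < a" for a
    using that excess_prob_inverse[of "a\<^sup>2"] by (simp add: p power_one_over)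
  have inc: "proj_prob (R a) (c a) < proj_prob (R b) (c b)" if "0 < a" "a < b" "b \<le> 1" for a b
    using that dec[of "1 / b" "1 / a"] inv[of a] inv[of b] by (simp add: frac_less2)
  show ?thesis
    unfolding Let_def by (rule unimodal_if_strict_mono_antimono[OF inc dec])
qed

end
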